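(* The class of hypotopologies is not simple.
   Context: Filters. For a set $X$, $\mathbb{F}X$ is the set of proper filters on $X$, ordered by inclusion ($\mathcal{F}\le\mathcal{G}$ iff $\mathcal{F}\subset\mathcal{G}$). Two filters $\mathcal{F},\mathcal{G}$ on $X$ mesh, written $\mathcal{F}\#\mathcal{G}$, if $F\cap G\neq\emptyset$ for all $F\in\mathcal{F}$, $G\in\mathcal{G}$. For $x\in X$, $\{x\}^{\uparrow}$ is the principal ultrafilter of $x$. For $f:X\to Y$ and a filter $\mathcal{F}$ on $X$, $f[\mathcal{F}]=\{B\subset Y: f^{-1}(B)\in\mathcal{F}\}$. A filter is countably complete if it is closed under countable intersections. Convergences. A convergence $\xi$ on a set $X=|\xi|$ is a relation between points $x\in X$ and filters $\mathcal{F}\in\mathbb{F}X$, written $x\in\lim_{\xi}\mathcal{F}$, such that $x\in\lim_\xi\{x\}^{\uparrow}$ for all $x\in X$, and $\lim_\xi\mathcal{F}\subset\lim_\xi\mathcal{G}$ whenever $\mathcal{F}\le\mathcal{G}$. For $f:X\to|\tau|$, $f^{-}\tau$ is the initial convergence on $X$: $x\in\lim_{f^{-}\tau}\mathcal{F}$ iff $f(x)\in\lim_\tau f[\mathcal{F}]$. For a family $\Xi$ of convergences on $X$, $\lim_{\bigvee\Xi}\mathcal{F}=\bigcap_{\xi\in\Xi}\lim_\xi\mathcal{F}$ (the empty supremum being the antidiscrete convergence, in which every filter converges to every point). The adherence of a filter $\mathcal{H}$ on $|\xi|$ is $\operatorname{adh}_\xi\mathcal{H}=\bigcup\{\lim_\xi\mathcal{G}:\mathcal{G}\in\mathbb{F}|\xi|,\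 \mathcal{G}\ge\mathcal{H}\}$. A convergence $\xi$ is a hypotopology if $x\in\lim_\xi\mathcal{F}$ whenever $x\in\operatorname{adh}_\xi\mathcal{D}$ for each countably complete filter $\mathcal{D}$ on $|\xi|$ with $\mathcal{D}\#\mathcal{F}$. Simplicity. A convergence $\eta$ is initially dense in a class $\Phi$ of convergences if $\eta\in\Phi$ and for every $\xi\in\Phi$ there is a set $A$ of maps from $|\xi|$ to $|\eta|$ with $\xi=\bigvee_{f\in A}f^{-}\eta$. A class $\Phi$ of convergences is simple if it includes a convergence that is initially dense in $\Phi$. *)

theory Defs
  imports Main "HOL.Filter" "HOL-Library.FuncSet" "HOL-Library.Countable_Set"
begin

text \<open>
  A filter on a subset \<open>X\<close> of a type is represented by a library filter containing \<open>X\<close>, that is,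
  one below \<open>principal X\<close>. Library filters may be improper (\<open>bot\<close>), and their order is the reverse
  of inclusion: \<open>G \<le> F\<close> says that the family \<open>F\<close> is included in the family \<open>G\<close>.
  The image \<open>f[F]\<close> is \<open>filtermap f F\<close>, and the principal ultrafilter of \<open>x\<close> is \<open>principal {x}\<close>.
\<close>

definition proper_filters :: "'a set \<Rightarrow> 'a filter set" where
  "proper_filters X = {F. F \<noteq> bot \<and> F \<le> principal X}"

definition mesh :: "'a filter \<Rightarrow> 'a filter \<Rightarrow> bool" (infix "\<sharp>" 50) where
  "F \<sharp> G \<longleftrightarrow>
    (\<forall>A B. eventually (\<lambda>x. x \<in> A) F \<longrightarrow> eventually (\<lambda>x. x \<in> B) G \<longrightarrow> A \<inter> B \<noteq> {})"

definition countably_complete :: "'a filter \<Rightarrow> bool" where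
  "countably_complete F \<longleftrightarrow>
    (\<forall>\<A>. countable \<A> \<longrightarrow> (\<forall>A\<in>\<A>. eventually (\<lambda>x. x \<in> A) F) \<longrightarrow>
      eventually (\<lambda>x. x \<in> \<Inter>\<A>) F)"

record 'a conv =
  points :: "'a set"
  limits :: "'a filter \<Rightarrow> 'a set"

text \<open>
  The first conjunct makes \<open>limits\<close> a relation between points and proper filters on the carrier;
  in particular \<open>limits\<close> is empty on all other filters, so that equality of records is equality
  of convergences.
\<close>

definition is_convergence :: "'a conv \<Rightarrow> bool" where
  "is_convergence \<xi> \<longleftrightarrow>
    (\<forall>F x. x \<in> limits \<xi> F \<longrightarrow> x \<in> points \<xi> \<and> F \<in> proper_filters (points \<xi>)) \<and>
    (\<forall>x\<in>points \<xi>. x \<in> limits \<xi> (principal {x})) \<and>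
    (\<forall>F\<in>proper_filters (points \<xi>). \<forall>G\<in>proper_filters (points \<xi>).
      G \<le> F \<longrightarrow> limits \<xi> F \<subseteq> limits \<xi> G)"

definition initial_conv :: "'a set \<Rightarrow> ('a \<Rightarrow> 'b) \<Rightarrow> 'b conv \<Rightarrow> 'a conv" where
  "initial_conv X f \<tau> =
    \<lparr>points = X,
     limits = (\<lambda>F. {x \<in> X. F \<in> proper_filters X \<and> f x \<in> limits \<tau> (filtermap f F)})\<rparr>"

definition Sup_conv :: "'a set \<Rightarrow> 'a conv set \<Rightarrow> 'a conv" where
  "Sup_conv X \<Xi> =
    \<lparr>points = X,
     limits = (\<lambda>F. {x \<in> X. F \<in> proper_filters X \<and> (\<forall>\<xi>\<in>\<Xi>. x \<in> limits \<xi> F)})\<rparr>"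

definition adherence :: "'a conv \<Rightarrow> 'a filter \<Rightarrow> 'a set" where
  "adherence \<xi> H = \<Union> {limits \<xi> G | G. G \<in> proper_filters (points \<xi>) \<and> G \<le> H}"

definition is_hypotopology :: "'a conv \<Rightarrow> bool" where
  "is_hypotopology \<xi> \<longleftrightarrow> is_convergence \<xi> \<and>
    (\<forall>F\<in>proper_filters (points \<xi>). \<forall>x\<in>points \<xi>.
      (\<forall>D\<in>proper_filters (points \<xi>).
        countably_complete D \<longrightarrow> D \<sharp> F \<longrightarrow> x \<in> adherence \<xi> D) \<longrightarrow>
      x \<in> limits \<xi> F)"

definition hypotopologies :: "'a conv set" where
  "hypotopologies = {\<xi>. is_hypotopology \<xi>}"

text \<open>
  A class of convergences on arbitrary sets is a polymorphic constant of type \<open>'a conv set\<close>, of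
  which a formula sees only one instance per type. The two definitions below therefore take two
  instances of the same class: \<open>\<Phi>\<close>, the part carried by subsets of \<open>'b\<close>, where the initially dense
  convergence is sought, and \<open>\<Psi>\<close>, the part carried by subsets of \<open>'a\<close>, whose members are to be
  represented. A class is simple if there is a type \<open>'b\<close> and an \<open>\<eta>\<close> in its \<open>'b\<close>-part that is initially
  dense in its \<open>'a\<close>-part for all types \<open>'a\<close>. Hence a class is not simple if every type \<open>'b\<close> has a
  type \<open>'a\<close>, depending on \<open>'b\<close> only, for which \<open>simple_class \<Phi> \<Psi>\<close> fails.
\<close>

definition initially_dense :: "'b conv \<Rightarrow> 'b conv set \<Rightarrow> 'a conv set \<Rightarrow> bool" where
  "initially_dense \<eta> \<Phi> \<Psi> \<longleftrightarrow> \<eta> \<in> \<Phi> \<and>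
    (\<forall>\<xi>\<in>\<Psi>. \<exists>A \<subseteq> points \<xi> \<rightarrow> points \<eta>.
      \<xi> = Sup_conv (points \<xi>) ((\<lambda>f. initial_conv (points \<xi>) f \<eta>) ` A))"

definition simple_class :: "'b conv set \<Rightarrow> 'a conv set \<Rightarrow> bool" where
  "simple_class \<Phi> \<Psi> \<longleftrightarrow> (\<exists>\<eta>. initially_dense \<eta> \<Phi> \<Psi>)"

end

theory Submission imports Defs "HOL-Library.Equipollence" begin

text \<open>
  A convergence on a set \<open>Y\<close> sees of another space only the fibres of a map into \<open>Y\<close>, and there
  are at most \<open>|Y|\<close> of them. So let \<open>X\<close> be a set that is larger than an infinite cardinal
  \<open>\<kappa> \<ge> |Y|\<close>, and let \<open>D\<close> be the filter of complements of subsets of \<open>X\<close> of size at most \<open>\<kappa>\<close>. It is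
  proper because \<open>X\<close> is large, and countably complete because a countable union of sets of size at
  most \<open>\<kappa>\<close> has size at most \<open>\<kappa>\<close>. Make all points of \<open>X\<close> isolated except one point \<open>p\<close>, to which
  precisely those filters converge that do not mesh \<open>D\<close>, i.e. that contain a set of size at most
  \<open>\<kappa>\<close> (\<open>avoiding_conv\<close>). Countable completeness of \<open>D\<close> makes this a hypotopology
  (\<open>hypotopology_avoiding_conv\<close>).

  In it \<open>D\<close> does not converge to \<open>p\<close>, but no continuous map \<open>f\<close> into a hypotopology \<open>\<eta>\<close> on \<open>Y\<close>
  notices this (\<open>hypotopology_limit_filtermap_cosmall\<close>). If \<open>f[D]\<close> failed to converge to \<open>f p\<close>, some
  filter \<open>H\<close> on \<open>Y\<close> would mesh \<open>f[D]\<close> without having \<open>f p\<close> as an adherent point. But the trace of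
  \<open>H\<close> on the range of \<open>f\<close> lifts, along a choice of one point in each fibre, to a filter on \<open>X\<close>
  that contains a set of size at most \<open>\<kappa>\<close>. The lifted filter converges to \<open>p\<close>, hence its image,
  which is finer than \<open>H\<close>, converges to \<open>f p\<close>: contradiction. A supremum of initial convergences
  along maps into \<open>\<eta>\<close> would therefore make \<open>D\<close> converge to \<open>p\<close>.
\<close>

lemma mesh_iff_inf: "F \<sharp> G \<longleftrightarrow> inf F G \<noteq> bot"
proof
  assume *: "F \<sharp> G"
  show "inf F G \<noteq> bot"
  proof
    assume "inf F G = bot"
    then obtain Q R where "eventually Q F" "eventually R G" "\<forall>x. \<not> (Q x \<and> R x)"
      unfolding trivial_limit_def eventually_inf by auto
    then show False
      using *[unfolded mesh_def, rule_format, of "Collect Q" "Collect R"] by auto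
  qed
next
  assume *: "inf F G \<noteq> bot"
  show "F \<sharp> G"
    unfolding mesh_def
  proof (intro allI impI)
    fix A B
    assume "eventually (\<lambda>x. x \<in> A) F" "eventually (\<lambda>x. x \<in> B) G"
    with * show "A \<inter> B \<noteq> {}"
      unfolding trivial_limit_def eventually_inf by blast
  qed
qed

lemma proper_filter_on_singleton:
  assumes "F \<noteq> bot" "F \<le> principal {x}"
  shows "F = principal {x}"
proof (rule antisym[OF assms(2)])
  show "principal {x} \<le> F"
    unfolding le_filter_def eventually_principal
  proof (intro allI impI ballI)
    fix P y
    assume P: "eventually P F" and y: "y \<in> {x}"
    have "eventually (\<lambda>z. z \<in> {x}) F"
      using assms(2) by (simp add: le_principal)
    then have "eventually (\<lambda>z. P y) F"
      using P by eventually_elim (use y in simp)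
    with assms(1) show "P y"
      by (simp add: eventually_const_iff)
  qed
qed

section \<open>Filters of complements of small sets\<close>

text \<open>
  For a finite nonempty \<open>K\<close> the predicate below need not be closed under conjunction, so that its
  abstraction to a filter is meaningful only for infinite \<open>K\<close>.
\<close>

definition cosmall :: "'k set \<Rightarrow> 'a filter" where
  "cosmall K = Abs_filter (\<lambda>P. {x. \<not> P x} \<lesssim> K)"

lemma lepoll_UN_infinite:
  assumes "infinite K" "I \<lesssim> K" "\<And>i. i \<in> I \<Longrightarrow> A i \<lesssim> K"
  shows "(\<Union>i\<in>I. A i) \<lesssim> K"
  using assms unfolding lepoll_def card_of_ordLeq
  by (intro card_of_UNION_ordLeq_infinite) auto

lemma eventually_cosmall:
  fixes K :: "'k set" and P :: "'a \<Rightarrow> bool"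
  assumes "infinite K"
  shows "eventually P (cosmall K) \<longleftrightarrow> {x. \<not> P x} \<lesssim> K"
  unfolding cosmall_def
proof (rule eventually_Abs_filter, rule is_filter.intro)
  fix P Q :: "'a \<Rightarrow> bool"
  assume "{x. \<not> P x} \<lesssim> K" "{x. \<not> Q x} \<lesssim> K"
  moreover have "{True, False} \<lesssim> K"
    by (simp add: finite_lepoll_infinite[OF assms])
  ultimately have "(\<Union>i\<in>{True, False}. if i then {x. \<not> P x} else {x. \<not> Q x}) \<lesssim> K"
    by (intro lepoll_UN_infinite[OF assms]) simp_all
  also have "(\<Union>i\<in>{True, False}. if i then {x. \<not> P x} else {x. \<not> Q x}) = {x. \<not> (P x \<and> Q x)}"
    by auto
  finally show "{x. \<not> (P x \<and> Q x)} \<lesssim> K" .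
next
  fix P Q :: "'a \<Rightarrow> bool"
  assume "\<forall>x. P x \<longrightarrow> Q x" "{x. \<not> P x} \<lesssim> K"
  then have "{x. \<not> Q x} \<lesssim> {x. \<not> P x}"
    by (intro subset_imp_lepoll) auto
  then show "{x. \<not> Q x} \<lesssim> K"
    using \<open>{x. \<not> P x} \<lesssim> K\<close> by (rule lepoll_trans)
qed simp

lemma cosmall_neq_bot:
  assumes "infinite K" "K \<prec> (UNIV :: 'a set)"
  shows "(cosmall K :: 'a filter) \<noteq> bot"
  using assms by (auto simp: trivial_limit_def eventually_cosmall lesspoll_def lepoll_antisym)

lemma countably_complete_cosmall:
  assumes "infinite K"
  shows "countably_complete (cosmall K :: 'a filter)"
  unfolding countably_complete_def
proof (intro allI impI)
  fix \<A> :: "'a set set"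
  assume \<A>: "countable \<A>" "\<forall>A\<in>\<A>. eventually (\<lambda>x. x \<in> A) (cosmall K)"
  have "\<A> \<lesssim> (UNIV :: nat set)"
    using \<A>(1) by (auto simp: countable_def lepoll_def)
  also have "\<dots> \<lesssim> K"
    using assms by (simp add: infinite_le_lepoll)
  finally have "(\<Union>A\<in>\<A>. {x. x \<notin> A}) \<lesssim> K"
    using \<A>(2) by (intro lepoll_UN_infinite[OF assms]) (auto simp: eventually_cosmall[OF assms])
  moreover have "(\<Union>A\<in>\<A>. {x. x \<notin> A}) = {x. x \<notin> \<Inter>\<A>}"
    by auto
  ultimately show "eventually (\<lambda>x. x \<in> \<Inter>\<A>) (cosmall K)"
    by (simp add: eventually_cosmall[OF assms])
qed

lemma eventually_neq_cosmall:
  assumes "infinite K"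
  shows "eventually (\<lambda>x. x \<noteq> p) (cosmall K)"
  using finite_lepoll_infinite[OF assms, of "{p}"] by (simp add: eventually_cosmall[OF assms])

lemma inf_cosmall_eq_bot:
  assumes "infinite K" "S \<lesssim> K" "eventually (\<lambda>x. x \<in> S) F"
  shows "inf (cosmall K) F = bot"
  unfolding trivial_limit_def eventually_inf
  using assms
  by (intro exI[of _ "\<lambda>x. x \<notin> S"] exI[of _ "\<lambda>x. x \<in> S"]) (simp add: eventually_cosmall)

section \<open>Convergences with a single non-isolated point\<close>

definition avoiding_conv :: "'a \<Rightarrow> 'a filter \<Rightarrow> 'a conv" where
  "avoiding_conv p D =
    \<lparr>points = UNIV,
     limits = (\<lambda>F. {x. F \<noteq> bot \<and> (if x = p then inf D F = bot else F = principal {x})})\<rparr>"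

lemma points_avoiding_conv [simp]: "points (avoiding_conv p D) = UNIV"
  by (simp add: avoiding_conv_def)

lemma limits_avoiding_conv_iff [simp]:
  "x \<in> limits (avoiding_conv p D) F \<longleftrightarrow>
    F \<noteq> bot \<and> (if x = p then inf D F = bot else F = principal {x})"
  by (simp add: avoiding_conv_def)

text \<open>
  At \<open>p\<close> the filter \<open>D\<close> itself witnesses every failure of convergence, since a proper filter finer
  than \<open>D\<close> meshes \<open>D\<close>. At an isolated point \<open>x\<close> the witness is the principal filter of the complement of
  \<open>x\<close>. The complement of \<open>p\<close> has to belong to \<open>D\<close> for the principal ultrafilter of \<open>p\<close>
  to converge to \<open>p\<close>.
\<close>

lemma hypotopology_avoiding_conv:
  assumes D: "countably_complete D" "eventually (\<lambda>x. x \<noteq> p) D"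
  shows "is_hypotopology (avoiding_conv p D)"
  unfolding is_hypotopology_def
proof
  show "is_convergence (avoiding_conv p D)"
    unfolding is_convergence_def
  proof (intro conjI allI impI ballI subsetI)
    fix x
    have "inf D (principal {p}) = bot"
      using D(2) by (simp add: trivial_limit_def eventually_inf_principal)
    then show "x \<in> limits (avoiding_conv p D) (principal {x})"
      by (simp add: principal_eq_bot_iff)
  next
    fix F G x
    assume "F \<in> proper_filters (points (avoiding_conv p D))"
      and "G \<in> proper_filters (points (avoiding_conv p D))"
      and le: "G \<le> F" and x: "x \<in> limits (avoiding_conv p D) F"
    then have G: "G \<noteq> bot"
      by (simp add: proper_filters_def)
    show "x \<in> limits (avoiding_conv p D) G"
    proof (cases "x = p")
      case True
      have "inf D G \<le> inf D F"
        using le by (rule inf_mono[OF order_refl])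
      with True x have "inf D G \<le> bot"
        by simp
      then show ?thesis
        using True G by (simp add: bot_unique)
    next
      case False
      then show ?thesis
        using proper_filter_on_singleton[OF G] x le G by simp
    qed
  qed (simp_all add: proper_filters_def)
next
  show "\<forall>F\<in>proper_filters (points (avoiding_conv p D)). \<forall>x\<in>points (avoiding_conv p D).
      (\<forall>E\<in>proper_filters (points (avoiding_conv p D)).
        countably_complete E \<longrightarrow> E \<sharp> F \<longrightarrow> x \<in> adherence (avoiding_conv p D) E) \<longrightarrow>
      x \<in> limits (avoiding_conv p D) F"
  proof (intro ballI impI)
    fix F x
    assume "F \<in> proper_filters (points (avoiding_conv p D))"
    then have F: "F \<noteq> bot" by (simp add: proper_filters_def)
    assume *: "\<forall>E\<in>proper_filters (points (avoiding_conv p D)).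
        countably_complete E \<longrightarrow> E \<sharp> F \<longrightarrow> x \<in> adherence (avoiding_conv p D) E"
    have adh: "\<exists>G. G \<noteq> bot \<and> G \<le> E \<and> x \<in> limits (avoiding_conv p D) G"
      if "E \<noteq> bot" "countably_complete E" "inf E F \<noteq> bot" for E
    proof -
      have "E \<in> proper_filters (points (avoiding_conv p D))"
        using that(1) by (simp add: proper_filters_def)
      with * that have "x \<in> adherence (avoiding_conv p D) E"
        unfolding mesh_iff_inf by blast
      then show ?thesis
        unfolding adherence_def proper_filters_def by blast
    qed
    show "x \<in> limits (avoiding_conv p D) F"
    proof (rule ccontr)
      assume not_lim: "x \<notin> limits (avoiding_conv p D) F"
      show False
      proof (cases "x = p")
        case True
        then have "inf D F \<noteq> bot"
          using not_lim F by simp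
        moreover from this have "D \<noteq> bot"
          by auto
        ultimately obtain G where "G \<noteq> bot" "G \<le> D" "p \<in> limits (avoiding_conv p D) G"
          using adh[of D] D(1) True by blast
        then show False
          by (simp add: inf_absorb2)
      next
        case False
        define E where "E = principal (- {x})"
        have "inf E F \<noteq> bot"
        proof
          assume "inf E F = bot"
          then have "eventually (\<lambda>y. y \<in> {x}) F"
            by (simp add: E_def inf_commute[of _ F] trivial_limit_def eventually_inf_principal)
          then have "F = principal {x}"
            using proper_filter_on_singleton[OF F] by (simp add: le_principal)
          with not_lim F False show False
            by simp
        qed
        moreover have "countably_complete E"
          by (auto simp: E_def countably_complete_def eventually_principal)
        moreover have "E \<noteq> bot"
          using \<open>inf E F \<noteq> bot\<close> by auto
        ultimately obtain G where G: "G \<le> E" "x \<in> limits (avoiding_conv p D) G"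
          using adh by blast
        from G(2) False have "G = principal {x}"
          by simp
        with G(1) show False
          by (simp add: E_def)
      qed
    qed
  qed
qed

section \<open>Maps into small hypotopologies\<close>

text \<open>
  The hypothesis is continuity at \<open>p\<close> of \<open>f\<close> on \<open>avoiding_conv p (cosmall K)\<close>, written out. One
  point from each fibre suffices to lift a filter along \<open>f\<close>, so the lifts can be taken to live on
  a small set, which is where continuity gives information.
\<close>

lemma hypotopology_limit_filtermap_cosmall:
  fixes f :: "'a \<Rightarrow> 'b" and K :: "'k set"
  assumes \<eta>: "is_hypotopology \<eta>"
    and f: "range f \<subseteq> points \<eta>"
    and K: "infinite K" "range f \<lesssim> K" "(cosmall K :: 'a filter) \<noteq> bot"
    and cont: "\<And>F. F \<noteq> bot \<Longrightarrow> inf (cosmall K) F = bot \<Longrightarrow> f p \<in> limits \<eta> (filtermap f F)"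
  shows "f p \<in> limits \<eta> (filtermap f (cosmall K))"
proof -
  have "f p \<in> adherence \<eta> H"
    if H: "H \<in> proper_filters (points \<eta>)" "H \<sharp> filtermap f (cosmall K)" for H
  proof -
    define H' where "H' = inf H (principal (range f))"
    define G where "G = filtermap (inv f) H'"
    have "filtermap f (cosmall K) \<le> principal (range f)"
      by (simp add: le_principal eventually_filtermap)
    then have "inf H (filtermap f (cosmall K)) \<le> H'"
      unfolding H'_def by (rule inf_mono[OF order_refl])
    with H(2) have "H' \<noteq> bot"
      by (auto simp: mesh_iff_inf bot_unique)
    then have "G \<noteq> bot"
      by (simp add: G_def filtermap_bot_iff)
    have "eventually (\<lambda>x. x \<in> inv f ` range f) G"
      by (simp add: G_def H'_def eventually_filtermap eventually_inf_principal)
    moreover have "inv f ` range f \<lesssim> K"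
      using image_lepoll K(2) by (rule lepoll_trans)
    ultimately have "inf (cosmall K) G = bot"
      using inf_cosmall_eq_bot[OF K(1)] by blast
    then have "f p \<in> limits \<eta> (filtermap f G)"
      using cont \<open>G \<noteq> bot\<close> by blast
    moreover have "filtermap f G \<le> H"
      by (auto simp: G_def H'_def le_filter_def eventually_filtermap eventually_inf_principal
          f_inv_into_f elim: eventually_mono)
    moreover from this have "filtermap f G \<in> proper_filters (points \<eta>)"
      using H(1) \<open>G \<noteq> bot\<close> by (auto simp: proper_filters_def filtermap_bot_iff)
    ultimately show ?thesis
      unfolding adherence_def by blast
  qed
  moreover have "filtermap f (cosmall K) \<in> proper_filters (points \<eta>)"
    using f K(3) by (simp add: proper_filters_def filtermap_bot_iff le_principal
        eventually_filtermap always_eventually range_subsetD)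
  ultimately show ?thesis
    using \<eta> f unfolding is_hypotopology_def by blast
qed

text \<open>
  The cardinal \<open>\<kappa>\<close> is that of \<open>'b + nat\<close>, which is infinite and bounds every range in \<open>'b\<close>; by
  Cantor's theorem its power set is large enough to be the carrier \<open>X\<close>.
\<close>

theorem corollary15:
  "\<not> simple_class (hypotopologies :: 'b conv set) (hypotopologies :: ('b + nat) set conv set)"
proof
  assume "simple_class (hypotopologies :: 'b conv set) (hypotopologies :: ('b + nat) set conv set)"
  then obtain \<eta> :: "'b conv" where \<eta>: "is_hypotopology \<eta>"
    and dense: "\<And>\<xi> :: ('b + nat) set conv. is_hypotopology \<xi> \<Longrightarrow> \<exists>A \<subseteq> points \<xi> \<rightarrow> points \<eta>.
      \<xi> = Sup_conv (points \<xi>) ((\<lambda>f. initial_conv (points \<xi>) f \<eta>) ` A)"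
    by (auto simp: simple_class_def initially_dense_def hypotopologies_def)
  define K where "K = (UNIV :: ('b + nat) set)"
  define D where "D = (cosmall K :: ('b + nat) set filter)"
  have K: "infinite K"
    by (simp add: K_def)
  have "K \<prec> (UNIV :: ('b + nat) set set)"
    using lesspoll_Pow_self[of K] by (simp add: K_def)
  then have D: "D \<noteq> bot"
    unfolding D_def using cosmall_neq_bot K by blast
  \<comment> \<open>Any point would do.\<close>
  define p :: "('b + nat) set" where "p = {}"
  define \<xi> where "\<xi> = avoiding_conv p D"
  have "is_hypotopology \<xi>"
    unfolding \<xi>_def D_def using K
    by (intro hypotopology_avoiding_conv countably_complete_cosmall eventually_neq_cosmall)
  moreover have points: "points \<xi> = UNIV"
    by (simp add: \<xi>_def)
  ultimately obtain A where A: "A \<subseteq> UNIV \<rightarrow> points \<eta>"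
    and \<xi>_eq: "\<xi> = Sup_conv UNIV ((\<lambda>f. initial_conv UNIV f \<eta>) ` A)"
    using dense[of \<xi>] by auto
  have lim_iff: "p \<in> limits \<xi> F \<longleftrightarrow> (\<forall>f\<in>A. f p \<in> limits \<eta> (filtermap f F))" if "F \<noteq> bot" for F
    using that by (subst \<xi>_eq) (simp add: Sup_conv_def initial_conv_def proper_filters_def)
  have lim_iff': "p \<in> limits \<xi> F \<longleftrightarrow> inf D F = bot" if "F \<noteq> bot" for F
    using that by (simp add: \<xi>_def)
  have "f p \<in> limits \<eta> (filtermap f D)" if "f \<in> A" for f
    unfolding D_def
  proof (rule hypotopology_limit_filtermap_cosmall[OF \<eta> _ K])
    show "range f \<subseteq> points \<eta>"
      using A that by auto
    have "range f \<lesssim> range (Inl :: 'b \<Rightarrow> 'b + nat)"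
      by (auto simp: lepoll_def intro!: exI[of _ Inl])
    also have "\<dots> \<lesssim> K"
      by (simp add: K_def subset_imp_lepoll)
    finally show "range f \<lesssim> K" .
    show "(cosmall K :: ('b + nat) set filter) \<noteq> bot"
      using D by (simp add: D_def)
  next
    fix F :: "('b + nat) set filter"
    assume "F \<noteq> bot" "inf (cosmall K) F = bot"
    then show "f p \<in> limits \<eta> (filtermap f F)"
      using that lim_iff lim_iff' by (auto simp: D_def)
  qed
  then have "p \<in> limits \<xi> D"
    using lim_iff[OF D] by blast
  with D show False
    using lim_iff' by auto
qed

end
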